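(* Fix an integer $K\ge 1$ and let $\Gamma(K)=1-\left(1-\frac{1}{K}\right)^K$. In the $K$-stage fractional vertex weighted matching problem, the algorithm PR-MWM described in the context is $\Gamma(K)$-competitive: for every instance $I$ with $K$ stages, the total weight $\sum_{j\in V} w_j\, y^{(K)}_j$ of the fractional matching it produces is at least $\Gamma(K)\cdot \mathrm{OPT}(I)$, where $\mathrm{OPT}(I)$ is the maximum weight of a fractional matching in the whole graph.
   Context: Multi-stage vertex weighted (fractional) matching: a bipartite graph $G=(U,V,E)$ with offline vertices $V$, each $j\in V$ having unit capacity and a weight $w_j\ge 0$. The online vertices arrive in $K$ stages: at stage $k\in[K]$ a nonempty batch $U_k\subseteq U$ arrives (the $U_k$ partition $U$) together with the set $E_k\subseteq E$ of its incident edges. After batch $k$ arrives the algorithm irrevocably chooses $x_k\in\mathbb{R}_{\ge 0}^{E_k}$ such that $\sum_{j:(i,j)\in E_k}x_{k,ij}\le 1$ for each $i\in U_k$ and the cumulative degree of each $j\in V$ over all stages is at most $1$. The objective is $\sum_j w_j\cdot(\text{final degree of }j)$; $\mathrm{OPT}(I)$ is the optimal value of $\max\{\sum_{(i,j)\in E}w_jx_{ij}: x\ge 0,\ \sum_{j}x_{ij}\le 1\ \forall i\in U,\ \sum_i x_{ij}\le 1\ \forall j\in V\}$. Regularizers: for $k\in[K-1]$ let $f_k(x)=\left(1-\frac{1-x}{K-k}\right)^{K-k}$ on $[0,1]$, and $f_K(x)=\mathbb{I}\{x=1\}$; let $F_k(x)=\int_0^x f_k(t)\,dt$ (so $F_K\equiv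 0$). Algorithm PR-MWM: set $y^{(0)}_j=0$ for all $j$. For $k=1,\dots,K$: after $U_k,E_k$ arrive, let $x^*_k$ be an optimal solution of $\max_{x\ge 0}\ \sum_{(i,j)\in E_k}w_jx_{ij}-\sum_{j\in V}w_jF_k\big(y^{(k-1)}_j+\sum_{i:(i,j)\in E_k}x_{ij}\big)$ subject to $\sum_{j:(i,j)\in E_k}x_{ij}\le 1$ for $i\in U_k$ and $\sum_{i:(i,j)\in E_k}x_{ij}\le 1-y^{(k-1)}_j$ for $j\in V$; output $x^*_k$ as the stage-$k$ matching and set $y^{(k)}_j=y^{(k-1)}_j+\sum_{i\in U_k}x^*_{k,ij}$. *)

theory Defs
  imports "HOL-Analysis.Analysis"
begin

text \<open>
  An instance consists of online vertices \<open>U\<close>, arriving in batches \<open>B 1, \<dots>, B K\<close>,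
  offline vertices \<open>V\<close>, edges \<open>E\<close> and offline vertex weights \<open>w\<close>. Values of \<open>B\<close> at indices
  outside \<open>{1..K}\<close>, of \<open>w\<close> outside \<open>V\<close>, and of edge vectors outside the relevant edge set are
  irrelevant.
\<close>

locale multistage_instance =
  fixes K :: nat
    and U :: "'u set"
    and B :: "nat \<Rightarrow> 'u set"
    and V :: "'v set"
    and E :: "('u \<times> 'v) set"
    and w :: "'v \<Rightarrow> real"
  assumes finite_U: "finite U"
    and finite_V: "finite V"
    and edges: "E \<subseteq> U \<times> V"
    and batch_nonempty: "\<And>k. k \<in> {1..K} \<Longrightarrow> B k \<noteq> {}"
    and batch_disjoint: "disjoint_family_on B {1..K}"
    and batch_cover: "(\<Union>k\<in>{1..K}. B k) = U"
    and weight_nonneg: "\<And>j. j \<in> V \<Longrightarrow> 0 \<le> w j"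

definition stage_edges :: "(nat \<Rightarrow> 'u set) \<Rightarrow> ('u \<times> 'v) set \<Rightarrow> nat \<Rightarrow> ('u \<times> 'v) set" where
  "stage_edges B E k = {e \<in> E. fst e \<in> B k}"

definition degree_off :: "('u \<times> 'v) set \<Rightarrow> ('u \<times> 'v \<Rightarrow> real) \<Rightarrow> 'v \<Rightarrow> real" where
  "degree_off D x j = (\<Sum>i | (i, j) \<in> D. x (i, j))"

definition frac_matching ::
  "'u set \<Rightarrow> 'v set \<Rightarrow> ('u \<times> 'v) set \<Rightarrow> ('v \<Rightarrow> real) \<Rightarrow> ('u \<times> 'v \<Rightarrow> real) \<Rightarrow> bool" where
  "frac_matching A V D c x \<longleftrightarrow>
     (\<forall>e\<in>D. 0 \<le> x e) \<and>
     (\<forall>i\<in>A. (\<Sum>j | (i, j) \<in> D. x (i, j)) \<le> 1) \<and>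
     (\<forall>j\<in>V. degree_off D x j \<le> c j)"

definition edge_weight :: "('u \<times> 'v) set \<Rightarrow> ('v \<Rightarrow> real) \<Rightarrow> ('u \<times> 'v \<Rightarrow> real) \<Rightarrow> real" where
  "edge_weight D w x = (\<Sum>(i, j)\<in>D. w j * x (i, j))"

definition OPT :: "'u set \<Rightarrow> 'v set \<Rightarrow> ('u \<times> 'v) set \<Rightarrow> ('v \<Rightarrow> real) \<Rightarrow> real" where
  "OPT U V E w = Sup {edge_weight E w x |x. frac_matching U V E (\<lambda>_. 1) x}"

definition reg_f :: "nat \<Rightarrow> nat \<Rightarrow> real \<Rightarrow> real" where
  "reg_f K k x =
     (if k < K then (1 - (1 - x) / real (K - k)) ^ (K - k) else of_bool (x = 1))"

definition reg_F :: "nat \<Rightarrow> nat \<Rightarrow> real \<Rightarrow> real" where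
  "reg_F K k x = integral {0..x} (reg_f K k)"

definition stage_objective ::
  "nat \<Rightarrow> nat \<Rightarrow> 'v set \<Rightarrow> ('u \<times> 'v) set \<Rightarrow> ('v \<Rightarrow> real) \<Rightarrow> ('v \<Rightarrow> real) \<Rightarrow> ('u \<times> 'v \<Rightarrow> real) \<Rightarrow> real"
where
  "stage_objective K k V D w y x =
     edge_weight D w x - (\<Sum>j\<in>V. w j * reg_F K k (y j + degree_off D x j))"

text \<open>\<open>A\<close> and \<open>D\<close> are the batch and the edges arriving in stage \<open>k\<close>; \<open>y\<close> holds the fill levels
  reached before that stage.\<close>

definition stage_optimal ::
  "nat \<Rightarrow> nat \<Rightarrow> 'u set \<Rightarrow> 'v set \<Rightarrow> ('u \<times> 'v) set \<Rightarrow> ('v \<Rightarrow> real) \<Rightarrow> ('v \<Rightarrow> real) \<Rightarrow>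
     ('u \<times> 'v \<Rightarrow> real) \<Rightarrow> bool"
where
  "stage_optimal K k A V D w y x \<longleftrightarrow>
     frac_matching A V D (\<lambda>j. 1 - y j) x \<and>
     (\<forall>z. frac_matching A V D (\<lambda>j. 1 - y j) z \<longrightarrow>
        stage_objective K k V D w y z \<le> stage_objective K k V D w y x)"

primrec fill ::
  "(nat \<Rightarrow> 'u set) \<Rightarrow> ('u \<times> 'v) set \<Rightarrow> (nat \<Rightarrow> 'u \<times> 'v \<Rightarrow> real) \<Rightarrow> nat \<Rightarrow> 'v \<Rightarrow> real" where
  "fill B E x 0 j = 0"
| "fill B E x (Suc k) j = fill B E x k j + degree_off (stage_edges B E (Suc k)) (x (Suc k)) j"

text \<open>The stage problems need not have unique optimal solutions, so the algorithm is modelled by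
  the predicate characterising its possible outputs \<open>x 1, \<dots>, x K\<close>, whatever optimal solution is
  selected in each stage.\<close>

definition PR_MWM ::
  "nat \<Rightarrow> (nat \<Rightarrow> 'u set) \<Rightarrow> 'v set \<Rightarrow> ('u \<times> 'v) set \<Rightarrow> ('v \<Rightarrow> real) \<Rightarrow>
     (nat \<Rightarrow> 'u \<times> 'v \<Rightarrow> real) \<Rightarrow> bool"
where
  "PR_MWM K B V E w x \<longleftrightarrow>
     (\<forall>k\<in>{1..K}.
        stage_optimal K k (B k) V (stage_edges B E k) w (fill B E x (k - 1)) (x k))"

definition ratio :: "nat \<Rightarrow> real" where
  "ratio K = 1 - (1 - 1 / real K) ^ K"

text \<open>Well-definedness: the supremum in \<open>OPT\<close> is attained, and every stage problem has an optimal
  solution, so \<open>PR_MWM\<close> is satisfiable on every instance (\<open>OPT_attained\<close>, \<open>PR_MWM_exists\<close>).\<close>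

lemma compact_box: "compact {x :: 'a \<Rightarrow> real. \<forall>e. x e \<in> (if e \<in> D then {0..1} else {0})}"
proof -
  have "compactin (product_topology (\<lambda>_. euclidean) UNIV) (PiE UNIV (\<lambda>e. if e \<in> D then {0..1} else {0::real}))"
    unfolding compactin_PiE by auto
  then show ?thesis
    by (simp add: euclidean_product_topology PiE_def Pi_def)
qed

lemma continuous_coord: "continuous_on S (\<lambda>x::'a \<Rightarrow> real. x e)"
  by (rule continuous_on_subset[OF continuous_on_product_coordinates]) simp

lemma continuous_degree_off:
  "continuous_on S (\<lambda>x::'u \<times> 'v \<Rightarrow> real. degree_off D x j)"
  unfolding degree_off_def by (intro continuous_intros) (rule continuous_coord)

lemma continuous_reg_f: "k < K \<Longrightarrow> continuous_on S (reg_f K k)"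
  unfolding reg_f_def by (auto intro!: continuous_intros)

lemma reg_F_last: "\<not> k < K \<Longrightarrow> reg_F K k x = 0"
proof -
  assume "\<not> k < K"
  have "((reg_f K k) has_integral 0) {0..x}"
    by (rule has_integral_spike_finite[where S="{1}" and f="\<lambda>_. 0"])
       (use \<open>\<not> k < K\<close> in \<open>auto simp: reg_f_def\<close>)
  then show ?thesis unfolding reg_F_def by (rule integral_unique)
qed

lemma continuous_reg_F: "continuous_on {0..1} (reg_F K k)"
proof (cases "k < K")
  case True
  have "reg_f K k integrable_on {0..1}"
    by (intro integrable_continuous_interval continuous_reg_f True)
  then show ?thesis unfolding reg_F_def by (rule indefinite_integral_continuous_1)
next
  case False
  have "reg_F K k = (\<lambda>_. 0)" using False by (auto simp: reg_F_last)
  then show ?thesis by simp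
qed

definition restr :: "'a set \<Rightarrow> ('a \<Rightarrow> real) \<Rightarrow> 'a \<Rightarrow> real" where
  "restr D x e = (if e \<in> D then x e else 0)"

lemma restr_simps:
  "degree_off D (restr D x) j = degree_off D x j"
  "edge_weight D w (restr D x) = edge_weight D w x"
  "frac_matching A V D c (restr D x) = frac_matching A V D c x"
proof -
  show 1: "degree_off D (restr D x) j = degree_off D x j" for j
    unfolding degree_off_def by (rule sum.cong) (auto simp: restr_def)
  show "edge_weight D w (restr D x) = edge_weight D w x"
    unfolding edge_weight_def by (rule sum.cong) (auto simp: restr_def)
  have "(\<Sum>j | (i, j) \<in> D. restr D x (i, j)) = (\<Sum>j | (i, j) \<in> D. x (i, j))" for i
    by (rule sum.cong) (auto simp: restr_def)
  then show "frac_matching A V D c (restr D x) = frac_matching A V D c x"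
    unfolding frac_matching_def 1 by (simp add: restr_def)
qed

lemma attains:
  fixes D :: "('u \<times> 'v) set" and obj :: "('u \<times> 'v \<Rightarrow> real) \<Rightarrow> real"
  assumes D: "finite D" "D \<subseteq> A \<times> V" and c: "\<And>j. j \<in> V \<Longrightarrow> 0 \<le> c j"
    and cont: "continuous_on {x. frac_matching A V D c x} obj"
    and restr: "\<And>x. obj (restr D x) = obj x"
  shows "\<exists>x. frac_matching A V D c x \<and> (\<forall>z. frac_matching A V D c z \<longrightarrow> obj z \<le> obj x)"
proof -
  let ?B = "{x :: 'u \<times> 'v \<Rightarrow> real. \<forall>e. x e \<in> (if e \<in> D then {0..1} else {0})}"
  let ?S = "{x. frac_matching A V D c x} \<inter> ?B"
  have fin: "finite {j. (i, j) \<in> D}" for i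
    by (rule finite_subset[of _ "snd ` D"]) (use D in force)+
  have "{x. frac_matching A V D c x} = (\<Inter>e\<in>D. {x. 0 \<le> x e}) \<inter> (\<Inter>i\<in>A. {x. (\<Sum>j | (i, j) \<in> D. x (i, j)) \<le> 1}) \<inter> (\<Inter>j\<in>V. {x. degree_off D x j \<le> c j})"
    by (auto simp: frac_matching_def)
  moreover have "closed \<dots>"
    by (intro closed_Int closed_INT ballI closed_Collect_le continuous_intros continuous_degree_off) (rule continuous_coord)+
  ultimately have "closed {x. frac_matching A V D c x}" by simp
  then have 1: "compact ?S" using compact_box[of D] by (simp add: closed_Int_compact)
  have "(\<lambda>_. 0) \<in> ?S" using c by (auto simp: frac_matching_def degree_off_def)
  then have 2: "?S \<noteq> {}" by (metis empty_iff)
  have 3: "continuous_on ?S obj" using cont by (rule continuous_on_subset) auto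
  have "\<exists>x\<in>?S. \<forall>z\<in>?S. obj z \<le> obj x"
    by (rule continuous_attains_sup[OF 1 2 3])
  then obtain x where x: "x \<in> ?S" "\<And>z. z \<in> ?S \<Longrightarrow> obj z \<le> obj x" by (elim bexE) (rule that, assumption, erule bspec)
  have "obj z \<le> obj x" if z: "frac_matching A V D c z" for z
  proof -
    have "z e \<le> 1" if "e \<in> D" for e
    proof -
      obtain i j where e: "e = (i, j)" by fastforce
      have "z (i,j) \<le> (\<Sum>j | (i, j) \<in> D. z (i, j))"
        by (rule member_le_sum) (use z that e fin in \<open>auto simp: frac_matching_def\<close>)
      also have "\<dots> \<le> 1" using z that e D by (auto simp: frac_matching_def)
      finally show ?thesis by (simp add: e)
    qed
    then have "restr D z \<in> ?S" using z by (auto simp: restr_simps) (auto simp: restr_def frac_matching_def)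
    from x(2)[OF this] show ?thesis by (simp only: restr)
  qed
  with x(1) show ?thesis by (intro exI[of _ x]) simp
qed

lemma OPT_attained:
  assumes "multistage_instance K U B V E w"
  shows "\<exists>x. frac_matching U V E (\<lambda>_. 1) x \<and> OPT U V E w = edge_weight E w x"
proof -
  interpret multistage_instance K U B V E w by fact
  have "finite E" using edges finite_U finite_V by (meson finite_SigmaI finite_subset)
  have "continuous_on S (edge_weight E w)" for S unfolding edge_weight_def
    unfolding split_beta by (intro continuous_intros) (rule continuous_coord)
  then obtain x where "frac_matching U V E (\<lambda>_. 1) x" "\<And>z. frac_matching U V E (\<lambda>_. 1) z \<Longrightarrow> edge_weight E w z \<le> edge_weight E w x"
    using attains[OF \<open>finite E\<close> edges, of "\<lambda>_. 1" "edge_weight E w"] restr_simps by force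
  then show ?thesis unfolding OPT_def
    by (intro exI[of _ x] conjI cSup_eq_maximum) auto
qed

lemma fill_cong: "(\<And>i. i \<in> {1..k} \<Longrightarrow> x i = z i) \<Longrightarrow> fill B E x k = fill B E z k"
proof (induction k)
  case (Suc k)
  then have "fill B E x k = fill B E z k" "x (Suc k) = z (Suc k)" by auto
  then show ?case by auto
qed auto

lemma degree_off_nonneg: "frac_matching A V D c x \<Longrightarrow> 0 \<le> degree_off D x j"
  by (auto simp: frac_matching_def degree_off_def intro!: sum_nonneg)

lemma stage_optimal_exists:
  assumes D: "finite D" "D \<subseteq> A \<times> V" and y: "\<And>j. j \<in> V \<Longrightarrow> y j \<in> {0..1}"
  shows "\<exists>x. stage_optimal K k A V D w y x"
  unfolding stage_optimal_def
proof (rule attains[OF D])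
  show "continuous_on {x. frac_matching A V D (\<lambda>j. 1 - y j) x} (stage_objective K k V D w y)"
    unfolding stage_objective_def edge_weight_def split_beta
  proof (intro continuous_intros)
    fix j assume j: "j \<in> V"
    have "y j + degree_off D x j \<in> {0..1}" if "frac_matching A V D (\<lambda>j. 1 - y j) x" for x
      using y[OF j] degree_off_nonneg[OF that, of j] that j by (auto simp: frac_matching_def)
    then show "continuous_on {x. frac_matching A V D (\<lambda>j. 1 - y j) x} (\<lambda>x. reg_F K k (y j + degree_off D x j))"
      by (intro continuous_on_compose2[OF continuous_reg_F] continuous_intros continuous_degree_off) auto
  qed (rule continuous_coord)
qed (use y in \<open>auto simp: stage_objective_def restr_simps\<close>)

lemma PR_MWM_exists:
  assumes "multistage_instance K U B V E w"
  shows "\<exists>x. PR_MWM K B V E w x"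
proof -
  interpret multistage_instance K U B V E w by fact
  have "finite E" using edges finite_U finite_V by (meson finite_SigmaI finite_subset)
  have "\<exists>x. (\<forall>k\<in>{1..n}. stage_optimal K k (B k) V (stage_edges B E k) w (fill B E x (k - 1)) (x k))
      \<and> (\<forall>j\<in>V. fill B E x n j \<in> {0..1})" for n
  proof (induction n)
    case (Suc n)
    then obtain x where x: "\<And>k. k\<in>{1..n} \<Longrightarrow> stage_optimal K k (B k) V (stage_edges B E k) w (fill B E x (k - 1)) (x k)"
      "\<And>j. j \<in> V \<Longrightarrow> fill B E x n j \<in> {0..1}" by blast
    obtain z where z: "stage_optimal K (Suc n) (B (Suc n)) V (stage_edges B E (Suc n)) w (fill B E x n) z"
      using stage_optimal_exists[of "stage_edges B E (Suc n)" "B (Suc n)" V "fill B E x n" K "Suc n" w]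
       x \<open>finite E\<close> edges by (force simp: stage_edges_def)
    let ?x = "x(Suc n := z)"
    have f: "fill B E ?x k = fill B E x k" if "k \<le> n" for k
      by (rule fill_cong) (use that in auto)
    have "fill B E ?x (Suc n) j \<in> {0..1}" if "j \<in> V" for j
      using x(2)[OF that] z that degree_off_nonneg[of "B (Suc n)" V "stage_edges B E (Suc n)" _ z j]
      by (auto simp: f stage_optimal_def) (auto simp: frac_matching_def)
    moreover have "stage_optimal K k (B k) V (stage_edges B E k) w (fill B E ?x (k - 1)) (?x k)" if "k \<in> {1..Suc n}" for k
      using that z x(1)[of k] f[of "k-1"] by (cases "k = Suc n") auto
    ultimately show ?case by blast
  qed simp
  then show ?thesis unfolding PR_MWM_def by blast
qed

end

theory Submission
  imports Defs
begin

text \<open>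
  Fix an optimal matching \<open>z\<close> of the whole graph and write \<open>d k j\<close>, \<open>z k j\<close> for the stage \<open>k\<close>
  degrees of \<open>j\<close> and \<open>y k j\<close> for its fill level. Since \<open>f k 1 = 1\<close> for \<open>k < K\<close>, saturated vertices
  drop out of the first-order condition of stage \<open>k\<close>, and moving from \<open>x k\<close> towards \<open>z\<close> yields
  \<open>\<Sum>j. w j * z k j * (1 - f k (y k j)) \<le> \<Sum>j. w j * d k j * (1 - f k (y k j))\<close>. In the last stage
  the feasible point \<open>(1 - y (K-1) j) * z\<close> takes the place of \<open>z\<close>. On the other hand, AM-GM gives
  inductively, for \<open>k < K\<close>, \<open>\<Sum>s\<le>k. d s j * f s (y s j) \<ge> f k (y k j) - (1 - 1/K)^K\<close>. Adding up all stages,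
  every unit of \<open>z k j\<close> is paid for with at least \<open>1 - (1 - 1/K)^K\<close>.
\<close>

section \<open>Monotonicity of the regularizers and convexity of their integrals\<close>

lemma reg_f_mono:
  assumes "k < K" "0 \<le> a" "a \<le> b"
  shows "reg_f K k a \<le> reg_f K k b"
proof -
  have "(1 - a) / real (K - k) \<le> 1"
    using assms by (simp add: divide_simps)
  moreover have "(1 - b) / real (K - k) \<le> (1 - a) / real (K - k)"
    using assms by (intro divide_right_mono) auto
  ultimately show ?thesis
    using assms by (auto simp: reg_f_def intro!: power_mono)
qed

lemma reg_f_nonneg:
  assumes "k < K" "0 \<le> a"
  shows "0 \<le> reg_f K k a"
  using assms by (auto simp: reg_f_def divide_simps)

text \<open>As the integral of a nondecreasing function, \<open>reg_F K k\<close> is convex on the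
  nonnegative reals. This is its tangent inequality with the slope taken at \<open>b\<close>, which
  may lie on either side of \<open>a\<close>, so that falling levels are covered as well as rising
  ones.\<close>

lemma reg_F_diff_le:
  assumes k: "k < K" and a: "0 \<le> a" and b: "0 \<le> b"
  shows "reg_F K k b - reg_F K k a \<le> (b - a) * reg_f K k b"
proof -
  have int: "reg_f K k integrable_on {p..q}" for p q
    by (intro integrable_continuous_interval continuous_reg_f k)
  have diff: "reg_F K k q - reg_F K k p = integral {p..q} (reg_f K k)" if "0 \<le> p" "p \<le> q" for p q
    using Henstock_Kurzweil_Integration.integral_combine[OF that int] unfolding reg_F_def by simp
  show ?thesis
  proof (cases "a \<le> b")
    case True
    have "integral {a..b} (reg_f K k) \<le> integral {a..b} (\<lambda>_. reg_f K k b)"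
      using a by (intro integral_le int) (auto intro: reg_f_mono[OF k])
    then show ?thesis using True a by (simp add: diff)
  next
    case False
    have "integral {b..a} (\<lambda>_. reg_f K k b) \<le> integral {b..a} (reg_f K k)"
      using b by (intro integral_le int) (auto intro: reg_f_mono[OF k])
    then show ?thesis using False b diff[of b a] by (simp add: algebra_simps)
  qed
qed

section \<open>AM-GM and the regularizer values accumulated over the stages\<close>

text \<open>AM-GM for one copy of \<open>a\<close> and \<open>n\<close> copies of \<open>b\<close>,
  derived from Bernoulli's inequality.\<close>

lemma mult_power_le_power_Suc_mean:
  fixes a b :: real
  assumes a: "0 \<le> a" and b: "0 \<le> b"
  shows "a * b ^ n \<le> ((a + real n * b) / real (Suc n)) ^ Suc n"
proof (cases "b = 0")
  case True
  then show ?thesis using a by (cases n) auto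
next
  case False
  \<comment> \<open>\<open>t\<close> is the relative deviation of the mean from \<open>b\<close>:
    the mean is \<open>b * (1 + t)\<close>, and the left-hand side of Bernoulli's inequality becomes
    exactly \<open>a / b\<close>.\<close>
  define t where "t = (a / b - 1) / real (Suc n)"
  have eq: "(a + real n * b) / real (Suc n) = b * (1 + t)"
  proof -
    have "(a + (m - 1) * b) / m = b * (1 + (a / b - 1) / m)" if "m > 0" for m
      using that False by (simp add: field_simps)
    from this[of "real (Suc n)"] show ?thesis by (simp add: t_def)
  qed
  have "0 \<le> a / b" using a b by simp
  then have "-1 \<le> t" by (simp add: t_def pos_le_divide_eq)
  then have "1 + real (Suc n) * t \<le> (1 + t) ^ Suc n"
    by (rule Bernoulli_inequality)
  moreover have "1 + real (Suc n) * t = a / b"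
    by (simp add: t_def del: of_nat_Suc)
  ultimately have "b ^ Suc n * (a / b) \<le> b ^ Suc n * (1 + t) ^ Suc n"
    using b by (intro mult_left_mono) auto
  then show ?thesis
    using False unfolding eq power_mult_distrib by (simp add: mult.commute)
qed

text \<open>AM-GM with the factor \<open>1 - (b - a)\<close> and \<open>n = K - Suc k\<close> copies
  of the base of \<open>reg_f K (Suc k) b\<close>. These sum to \<open>n + a\<close>, so their mean
  is the base of \<open>reg_f K k a\<close>, whose exponent is \<open>n + 1\<close>.\<close>

lemma reg_f_step:
  assumes k: "Suc k < K" and ab: "0 \<le> a" "a \<le> b" "b \<le> 1"
  shows "(1 - (b - a)) * reg_f K (Suc k) b \<le> reg_f K k a"
proof -
  define n where "n = K - Suc k"
  have n: "n > 0" "K - k = Suc n" using k by (auto simp: n_def)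
  have "(1 - (b - a)) * (1 - (1 - b) / n) ^ n
      \<le> ((1 - (b - a) + real n * (1 - (1 - b) / n)) / real (Suc n)) ^ Suc n"
    using ab n by (intro mult_power_le_power_Suc_mean) (auto simp: divide_simps)
  also have "(1 - (b - a) + real n * (1 - (1 - b) / n)) / real (Suc n) = 1 - (1 - a) / real (Suc n)"
  proof -
    define m where "m = real (Suc n)"
    have "m > 0" by (simp add: m_def)
    have "real n * ((1 - b) / n) = 1 - b" using n by simp
    then have m: "real n * (1 - (1 - b) / n) = m - 1 - (1 - b)"
      unfolding right_diff_distrib[of "real n" 1] by (simp add: m_def)
    show ?thesis
      unfolding m m_def[symmetric] using \<open>m > 0\<close> by (simp add: field_simps)
  qed
  finally show ?thesis
    using k n by (simp add: reg_f_def n_def)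
qed

text \<open>Telescoping of \<open>reg_f_step\<close>: each stage adds at least the increase of
  \<open>reg_f K k (y k)\<close>. The subtracted constant is \<open>reg_f K 0 0\<close>, the value
  of the formula at a fictitious empty stage 0, which makes both sides vanish at
  \<open>k = 0\<close>.\<close>

lemma reg_f_le_sum:
  fixes y :: "nat \<Rightarrow> real"
  assumes "y 0 = 0" "k < K"
    and mono: "\<And>s. s < k \<Longrightarrow> y s \<le> y (Suc s)"
    and range: "\<And>s. s \<le> k \<Longrightarrow> y s \<in> {0..1}"
  shows "reg_f K k (y k) - (1 - 1 / real K) ^ K
    \<le> (\<Sum>s=1..k. (y s - y (s - 1)) * reg_f K s (y s))"
  using \<open>k < K\<close> mono range
proof (induction k)
  case 0
  then show ?case using \<open>y 0 = 0\<close> by (simp add: reg_f_def)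
next
  case (Suc k)
  have "(1 - (y (Suc k) - y k)) * reg_f K (Suc k) (y (Suc k)) \<le> reg_f K k (y k)"
    using Suc.prems(1) Suc.prems(2)[of k] Suc.prems(3)[of k] Suc.prems(3)[of "Suc k"]
    by (intro reg_f_step) auto
  moreover have "reg_f K k (y k) - (1 - 1 / real K) ^ K
    \<le> (\<Sum>s=1..k. (y s - y (s - 1)) * reg_f K s (y s))"
    by (rule Suc.IH) (use Suc.prems in auto)
  ultimately show ?case by (simp add: algebra_simps)
qed

section \<open>Weights and feasibility in terms of offline degrees\<close>

lemma edge_weight_eq_degrees:
  assumes D: "finite D" "D \<subseteq> A \<times> V" and V: "finite V"
  shows "edge_weight D w x = (\<Sum>j\<in>V. w j * degree_off D x j)"
proof -
  have "edge_weight D w x = (\<Sum>j\<in>V. \<Sum>e | e \<in> D \<and> snd e = j. w (snd e) * x e)"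
    unfolding edge_weight_def split_beta
    using D by (subst sum.group[OF D(1) V]) auto
  also have "\<dots> = (\<Sum>j\<in>V. w j * degree_off D x j)"
  proof (rule sum.cong[OF refl])
    fix j
    have "(\<Sum>e | e \<in> D \<and> snd e = j. w (snd e) * x e) = (\<Sum>i | (i, j) \<in> D. w j * x (i, j))"
      by (rule sum.reindex_bij_witness[where i = "\<lambda>i. (i, j)" and j = fst]) auto
    then show "(\<Sum>e | e \<in> D \<and> snd e = j. w (snd e) * x e) = w j * degree_off D x j"
      by (simp add: degree_off_def sum_distrib_left)
  qed
  finally show ?thesis .
qed

text \<open>Shrinking edge values preserves the online constraints, so only the offline capacities
  have to be checked anew. It serves for \<open>z\<close> truncated at saturated vertices and for
  \<open>z\<close> scaled by residual capacities.\<close>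

lemma frac_matching_mono:
  assumes m: "frac_matching A V D c z" and D: "finite D"
    and v: "\<And>e. e \<in> D \<Longrightarrow> 0 \<le> v e" "\<And>e. e \<in> D \<Longrightarrow> v e \<le> z e"
    and c: "\<And>j. j \<in> V \<Longrightarrow> degree_off D v j \<le> c' j"
  shows "frac_matching A V D c' v"
proof -
  have "(\<Sum>j | (i, j) \<in> D. v (i, j)) \<le> 1" if "i \<in> A" for i
  proof -
    have "(\<Sum>j | (i, j) \<in> D. v (i, j)) \<le> (\<Sum>j | (i, j) \<in> D. z (i, j))"
      by (rule sum_mono) (use v in auto)
    with m that show ?thesis by (force simp: frac_matching_def)
  qed
  with v(1) c show ?thesis by (auto simp: frac_matching_def)
qed

section \<open>Consequences of optimality within one stage\<close>

text \<open>A variational inequality, obtained by perturbing \<open>x\<close> directly instead of by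
  dual multipliers. The competitor \<open>z\<close> respects unit capacities but may exceed the
  residual ones, \<open>1 - y j\<close>.\<close>

lemma stage_first_order:
  assumes k: "k < K" and D: "finite D" "D \<subseteq> A \<times> V" and V: "finite V"
    and y: "\<And>j. j \<in> V \<Longrightarrow> 0 \<le> y j" and w: "\<And>j. j \<in> V \<Longrightarrow> 0 \<le> w j"
    and x: "stage_optimal K k A V D w y x" and z: "frac_matching A V D (\<lambda>_. 1) z"
  shows "(\<Sum>j\<in>V. w j * degree_off D z j * (1 - reg_f K k (y j + degree_off D x j)))
    \<le> (\<Sum>j\<in>V. w j * degree_off D x j * (1 - reg_f K k (y j + degree_off D x j)))"
proof -
  define Y where "Y j = y j + degree_off D x j" for j
  \<comment> \<open>At a saturated vertex even a short move towards \<open>z\<close> may break the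
    capacity, so \<open>z\<close> is set to 0 on the edges there. Elsewhere the slack leaves room
    for a short move.\<close>
  define v where "v e = (if Y (snd e) < 1 then z e else 0)" for e
  define q where "q \<epsilon> e = (1 - \<epsilon>) * x e + \<epsilon> * v e" for \<epsilon> e
  define \<delta> where "\<delta> j = degree_off D v j - degree_off D x j" for j
  have xf: "frac_matching A V D (\<lambda>j. 1 - y j) x" using x by (simp add: stage_optimal_def)
  have Y1: "Y j \<le> 1" if "j \<in> V" for j using xf that by (auto simp: frac_matching_def Y_def)
  have dv: "degree_off D v j = (if Y j < 1 then degree_off D z j else 0)" for j
    by (simp add: degree_off_def v_def)
  have vf: "frac_matching A V D (\<lambda>_. 1) v"
    using z by (intro frac_matching_mono[OF z D(1)]) (auto simp: dv, auto simp: v_def frac_matching_def)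
  have dq: "y j + degree_off D (q \<epsilon>) j = Y j + \<epsilon> * \<delta> j" for \<epsilon> j
    by (simp add: degree_off_def q_def \<delta>_def Y_def sum.distrib sum_subtractf algebra_simps
        flip: sum_distrib_left)
  have "\<forall>\<^sub>F \<epsilon> in at_right 0. Y j + \<epsilon> * \<delta> j \<le> 1" if "j \<in> V" for j
  proof (cases "Y j < 1")
    case True
    have "((\<lambda>\<epsilon>. Y j + \<epsilon> * \<delta> j) \<longlongrightarrow> Y j + 0 * \<delta> j) (at_right 0)"
      by (intro tendsto_intros)
    from order_tendstoD(2)[OF this, of 1] True show ?thesis
      by (auto elim: eventually_mono)
  next
    case False
    \<comment> \<open>Since \<open>v\<close> has degree 0 at a saturated vertex, the move can only
      lower the level there.\<close>
    have "\<delta> j \<le> 0" using False degree_off_nonneg[OF xf] by (auto simp: \<delta>_def dv)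
    with Y1[OF that] have "Y j + \<epsilon> * \<delta> j \<le> 1" if "0 < \<epsilon>" for \<epsilon>
      using mult_nonneg_nonpos[of \<epsilon> "\<delta> j"] that by auto
    then show ?thesis by (auto intro: eventually_mono[OF eventually_at_right_less])
  qed
  then have ev: "\<forall>\<^sub>F \<epsilon> in at_right 0. \<forall>j\<in>V. Y j + \<epsilon> * \<delta> j \<le> 1"
    using V by (simp add: eventually_ball_finite_distrib)
  have "\<forall>\<^sub>F \<epsilon> in at_right (0::real). \<epsilon> < 1"
    by (rule order_tendstoD[OF tendsto_ident_at]) simp
  with ev eventually_at_right_less[of 0]
  have "\<forall>\<^sub>F \<epsilon> in at_right 0. (\<Sum>j\<in>V. w j * (\<delta> j * (1 - reg_f K k (Y j + \<epsilon> * \<delta> j)))) \<le> 0"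
  proof eventually_elim
    fix \<epsilon> :: real
    assume e: "\<forall>j\<in>V. Y j + \<epsilon> * \<delta> j \<le> 1" "0 < \<epsilon>" "\<epsilon> < 1"
    have "(\<Sum>j | (i, j) \<in> D. q \<epsilon> (i, j)) \<le> 1" if "i \<in> A" for i
    proof -
      have "(\<Sum>j | (i, j) \<in> D. q \<epsilon> (i, j))
          = (1 - \<epsilon>) * (\<Sum>j | (i, j) \<in> D. x (i, j)) + \<epsilon> * (\<Sum>j | (i, j) \<in> D. v (i, j))"
        by (simp add: q_def sum.distrib sum_distrib_left)
      also have "\<dots> \<le> 1"
        using xf vf that e by (intro convex_bound_le) (auto simp: frac_matching_def)
      finally show ?thesis .
    qed
    moreover have "degree_off D (q \<epsilon>) j \<le> 1 - y j" if "j \<in> V" for j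
      using e(1) that dq[of j \<epsilon>] by force
    moreover have "0 \<le> q \<epsilon> e" if "e \<in> D" for e
      using xf vf that e by (auto simp: q_def frac_matching_def)
    ultimately have qf: "frac_matching A V D (\<lambda>j. 1 - y j) (q \<epsilon>)"
      by (auto simp: frac_matching_def)
    have "\<epsilon> * (\<Sum>j\<in>V. w j * (\<delta> j * (1 - reg_f K k (Y j + \<epsilon> * \<delta> j))))
        = (\<Sum>j\<in>V. w j * (\<epsilon> * \<delta> j - (\<epsilon> * \<delta> j) * reg_f K k (Y j + \<epsilon> * \<delta> j)))"
      by (simp add: sum_distrib_left algebra_simps)
    \<comment> \<open>The slope is taken at the moved point, the side on which convexity bounds the
      change of the objective from below; letting \<epsilon> tend to 0 brings the slope back to
      \<open>Y j\<close>.\<close>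
    also have "\<dots> \<le> (\<Sum>j\<in>V. w j * (\<epsilon> * \<delta> j - (reg_F K k (Y j + \<epsilon> * \<delta> j) - reg_F K k (Y j))))"
    proof (intro sum_mono mult_left_mono diff_left_mono w)
      fix j assume j: "j \<in> V"
      have "0 \<le> Y j" "0 \<le> Y j + \<epsilon> * \<delta> j"
        using y[OF j] degree_off_nonneg[OF xf, of j] degree_off_nonneg[OF qf, of j] dq[of j \<epsilon>]
        by (auto simp: Y_def)
      from reg_F_diff_le[OF k this]
      show "reg_F K k (Y j + \<epsilon> * \<delta> j) - reg_F K k (Y j) \<le> \<epsilon> * \<delta> j * reg_f K k (Y j + \<epsilon> * \<delta> j)"
        by simp
    qed
    also have "\<dots> = stage_objective K k V D w y (q \<epsilon>) - stage_objective K k V D w y x"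
    proof -
      have "degree_off D (q \<epsilon>) j = degree_off D x j + \<epsilon> * \<delta> j" for j
        using dq[of j \<epsilon>] by (simp add: Y_def)
      then show ?thesis
        unfolding stage_objective_def edge_weight_eq_degrees[OF D V] dq Y_def[symmetric]
        by (simp add: algebra_simps sum.distrib sum_subtractf)
    qed
    also have "\<dots> \<le> 0" using x qf by (simp add: stage_optimal_def)
    finally show "(\<Sum>j\<in>V. w j * (\<delta> j * (1 - reg_f K k (Y j + \<epsilon> * \<delta> j)))) \<le> 0"
      using e(2) by (simp add: mult_le_0_iff)
  qed
  moreover have "((\<lambda>\<epsilon>. \<Sum>j\<in>V. w j * (\<delta> j * (1 - reg_f K k (Y j + \<epsilon> * \<delta> j))))
      \<longlongrightarrow> (\<Sum>j\<in>V. w j * (\<delta> j * (1 - reg_f K k (Y j + 0 * \<delta> j))))) (at_right 0)"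
    unfolding reg_f_def if_P[OF k] by (intro tendsto_intros) (use k in auto)
  ultimately have "(\<Sum>j\<in>V. w j * (\<delta> j * (1 - reg_f K k (Y j)))) \<le> 0"
    by (auto dest: tendsto_upperbound)
  moreover have "w j * (\<delta> j * (1 - reg_f K k (Y j)))
      = w j * degree_off D z j * (1 - reg_f K k (Y j)) - w j * degree_off D x j * (1 - reg_f K k (Y j))"
    if "j \<in> V" for j
  proof (cases "Y j < 1")
    \<comment> \<open>The truncation changed \<delta> here, but the factor
      \<open>1 - reg_f K k 1\<close> is 0, so the degree of \<open>z\<close> can be
      reinstated.\<close>
    case False
    with Y1[OF that] have "reg_f K k (Y j) = 1" using k by (auto simp: reg_f_def)
    then show ?thesis by simp
  qed (simp add: \<delta>_def dv algebra_simps)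
  ultimately show ?thesis by (simp add: sum_subtractf Y_def)
qed

text \<open>\<open>reg_F K K\<close> vanishes, so this stage maximizes the plain weight and can be
  compared with any feasible point. Scaling \<open>z\<close> by \<open>1 - y j\<close> meets the
  residual capacities because \<open>z\<close> has degree at most 1.\<close>

lemma last_stage_bound:
  assumes D: "finite D" "D \<subseteq> A \<times> V" and V: "finite V"
    and y: "\<And>j. j \<in> V \<Longrightarrow> y j \<in> {0..1}"
    and x: "stage_optimal K K A V D w y x" and z: "frac_matching A V D (\<lambda>_. 1) z"
  shows "(\<Sum>j\<in>V. w j * degree_off D z j * (1 - y j)) \<le> (\<Sum>j\<in>V. w j * degree_off D x j)"
proof -
  define v where "v e = (1 - y (snd e)) * z e" for e
  have dv: "degree_off D v j = (1 - y j) * degree_off D z j" for j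
    by (simp add: degree_off_def v_def sum_distrib_left)
  have "frac_matching A V D (\<lambda>j. 1 - y j) v"
  proof (rule frac_matching_mono[OF z D(1)])
    fix e assume e: "e \<in> D"
    then have "y (snd e) \<in> {0..1}" using D y by auto
    moreover have "0 \<le> z e" using e z by (auto simp: frac_matching_def)
    ultimately show "0 \<le> v e" "v e \<le> z e" by (auto simp: v_def mult_left_le_one_le)
  next
    fix j assume j: "j \<in> V"
    then show "degree_off D v j \<le> 1 - y j"
      using y[OF j] z by (auto simp: dv frac_matching_def intro!: mult_left_le)
  qed
  then have "edge_weight D w v \<le> edge_weight D w x"
    using x by (simp add: stage_optimal_def stage_objective_def reg_F_last)
  then show ?thesis
    by (simp add: edge_weight_eq_degrees[OF D V] dv mult_ac)
qed

section \<open>Fill levels, and restriction of a matching to the stages\<close>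

lemma fill_range:
  assumes "PR_MWM K B V E w x" "j \<in> V" "k \<le> K"
  shows "fill B E x k j \<in> {0..1}"
    and "k < K \<Longrightarrow> fill B E x k j \<le> fill B E x (Suc k) j"
proof -
  have step: "frac_matching (B (Suc k)) V (stage_edges B E (Suc k)) (\<lambda>j. 1 - fill B E x k j) (x (Suc k))"
    if "k < K" for k
    using assms(1) that unfolding PR_MWM_def stage_optimal_def by force
  show "k < K \<Longrightarrow> fill B E x k j \<le> fill B E x (Suc k) j"
    using degree_off_nonneg[OF step] by simp
  show "fill B E x k j \<in> {0..1}"
    using \<open>k \<le> K\<close>
  proof (induction k)
    case (Suc k)
    then show ?case
      using step[of k] degree_off_nonneg[OF step[of k], of j] \<open>j \<in> V\<close>
      by (auto simp: frac_matching_def)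
  qed simp
qed

lemma fill_eq_sum: "fill B E x k j = (\<Sum>s=1..k. degree_off (stage_edges B E s) (x s) j)"
  by (induction k) auto

lemma degree_off_eq_sum_stages:
  assumes "multistage_instance K U B V E w"
  shows "degree_off E z j = (\<Sum>k=1..K. degree_off (stage_edges B E k) z j)"
proof -
  interpret multistage_instance K U B V E w by fact
  have fin: "finite {i. (i, j) \<in> stage_edges B E k}" for k
    by (rule finite_subset[OF _ finite_U]) (use edges in \<open>auto simp: stage_edges_def\<close>)
  have "{i. (i, j) \<in> E} = (\<Union>k\<in>{1..K}. {i. (i, j) \<in> stage_edges B E k})"
    using edges batch_cover by (auto simp: stage_edges_def)
  moreover have "{i. (i, j) \<in> stage_edges B E k} \<inter> {i. (i, j) \<in> stage_edges B E l} = {}"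
    if "k \<in> {1..K}" "l \<in> {1..K}" "k \<noteq> l" for k l
    using disjoint_family_onD[OF batch_disjoint that] by (auto simp: stage_edges_def)
  ultimately show ?thesis
    unfolding degree_off_def using fin by (simp add: sum.UNION_disjoint)
qed

text \<open>A stage contains all edges of its batch, so online degrees are unchanged, while offline
  degrees can only drop. This makes the global optimum a competitor in every stage.\<close>

lemma frac_matching_stage:
  assumes z: "frac_matching U V E (\<lambda>_. 1) z" and E: "finite E" and B: "B k \<subseteq> U"
  shows "frac_matching (B k) V (stage_edges B E k) (\<lambda>_. 1) z"
proof -
  have nn: "\<And>e. e \<in> E \<Longrightarrow> 0 \<le> z e" using z by (simp add: frac_matching_def)
  have fin: "finite {i. (i, j) \<in> E}" for j
    by (rule finite_subset[of _ "fst ` E"]) (use E in force)+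
  have "degree_off (stage_edges B E k) z j \<le> 1" if "j \<in> V" for j
  proof -
    have "degree_off (stage_edges B E k) z j \<le> degree_off E z j"
      unfolding degree_off_def
      by (rule sum_mono2[OF fin]) (auto simp: stage_edges_def nn)
    also have "\<dots> \<le> 1" using z that by (simp add: frac_matching_def)
    finally show ?thesis .
  qed
  moreover have "(\<Sum>j | (i, j) \<in> stage_edges B E k. z (i, j)) = (\<Sum>j | (i, j) \<in> E. z (i, j))"
    if "i \<in> B k" for i
    by (rule sum.cong) (use that in \<open>auto simp: stage_edges_def\<close>)
  ultimately show ?thesis
    using z B nn unfolding frac_matching_def by (auto simp: stage_edges_def)
qed

section \<open>Charging the optimum to the stages\<close>

theorem theorem1:
  fixes K :: nat
    and U :: "'u set"
    and B :: "nat \<Rightarrow> 'u set"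
    and V :: "'v set"
    and E :: "('u \<times> 'v) set"
    and w :: "'v \<Rightarrow> real"
    and x :: "nat \<Rightarrow> 'u \<times> 'v \<Rightarrow> real"
  assumes "K \<ge> 1"
    and "multistage_instance K U B V E w"
    and "PR_MWM K B V E w x"
  shows "(\<Sum>j\<in>V. w j * fill B E x K j) \<ge> ratio K * OPT U V E w"
proof -
  interpret multistage_instance K U B V E w by fact
  have E: "finite E" using edges finite_U finite_V by (meson finite_SigmaI finite_subset)
  obtain z where z: "frac_matching U V E (\<lambda>_. 1) z" and opt: "OPT U V E w = edge_weight E w z"
    using OPT_attained[OF assms(2)] by blast
  \<comment> \<open>The \<open>N\<close> stages before the last are those with a continuous
    regularizer; the last one is treated apart.\<close>
  obtain N where N: "K = Suc N" using \<open>K \<ge> 1\<close> by (cases K) auto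
  define D where "D k = stage_edges B E k" for k
  define y where "y k j = fill B E x k j" for k j
  define d where "d k j = degree_off (D k) (x k) j" for k j
  define zd where "zd k j = degree_off (D k) z j" for k j
  define f where "f k j = reg_f K k (y k j)" for k j
  define c where "c = (1 - 1 / real K) ^ K"
  have D: "finite (D k)" "D k \<subseteq> B k \<times> V" for k
    using E edges by (auto simp: D_def stage_edges_def)
  have Bk: "B k \<subseteq> U" if "k \<in> {1..K}" for k using batch_cover that by blast
  have opt_k: "stage_optimal K k (B k) V (D k) w (y (k - 1)) (x k)" if "k \<in> {1..K}" for k
    using assms(3) that unfolding PR_MWM_def D_def y_def by auto
  have zk: "frac_matching (B k) V (D k) (\<lambda>_. 1) z" if "k \<in> {1..K}" for k
    unfolding D_def using frac_matching_stage[of U V E z B k] z E Bk[OF that] by blast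
  have y01: "y k j \<in> {0..1}" if "j \<in> V" "k \<le> K" for k j
    unfolding y_def by (rule fill_range(1)[OF assms(3) that])
  have yd: "y k j = y (k - 1) j + d k j" if "k \<in> {1..K}" for k j
    using that by (cases k) (auto simp: y_def d_def D_def)
  have zd0: "0 \<le> zd k j" if "k \<in> {1..K}" for k j
    unfolding zd_def by (rule degree_off_nonneg[OF zk[OF that]])
  have d0: "0 \<le> d k j" if "k \<in> {1..K}" for k j
    unfolding d_def
    by (rule degree_off_nonneg[OF conjunct1[OF opt_k[OF that, unfolded stage_optimal_def]]])
  \<comment> \<open>The stage gain \<open>d k j\<close> is split: the part weighted by
    \<open>1 - f k j\<close> pays for \<open>zd k j\<close>, the part weighted by
    \<open>f k j\<close> is kept as credit of \<open>j\<close>.\<close>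
  have early: "(\<Sum>j\<in>V. w j * (zd k j * (1 - f k j) + d k j * f k j)) \<le> (\<Sum>j\<in>V. w j * d k j)"
    if "k \<in> {1..N}" for k
  proof -
    have k: "k \<in> {1..K}" "k < K" using that N by auto
    have "(\<Sum>j\<in>V. w j * zd k j * (1 - reg_f K k (y (k - 1) j + d k j)))
      \<le> (\<Sum>j\<in>V. w j * d k j * (1 - reg_f K k (y (k - 1) j + d k j)))"
      unfolding zd_def d_def
      by (rule stage_first_order[OF k(2) D finite_V _ _ opt_k zk])
        (use k weight_nonneg y01[of _ "k - 1"] in auto)
    then show ?thesis
      by (simp add: f_def yd[OF k(1)] algebra_simps sum.distrib sum_subtractf)
  qed
  have "(\<Sum>j\<in>V. w j * zd K j * (1 - y (K - 1) j)) \<le> (\<Sum>j\<in>V. w j * d K j)"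
    unfolding zd_def d_def
    by (rule last_stage_bound[OF D finite_V _ opt_k zk]) (use y01 N in auto)
  then have late: "(\<Sum>j\<in>V. w j * (zd K j * (1 - y N j))) \<le> (\<Sum>j\<in>V. w j * d K j)"
    using N by (simp add: mult.assoc)
  \<comment> \<open>Each unit of \<open>zd k j\<close> receives \<open>1 - f k j\<close> directly
    and the pooled credit \<open>S N\<close>, which is at least \<open>f k j - c\<close>; together
    at least \<open>1 - c\<close>.\<close>
  have point: "(1 - c) * degree_off E z j
      \<le> (\<Sum>k=1..N. zd k j * (1 - f k j) + d k j * f k j) + zd K j * (1 - y N j)" if j: "j \<in> V" for j
  proof -
    define S where "S k = (\<Sum>s=1..k. d s j * f s j)" for k
    have S: "f k j - c \<le> S k" if "k \<le> N" for k
    proof -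
      have "f k j - c \<le> (\<Sum>s=1..k. (y s j - y (s - 1) j) * reg_f K s (y s j))"
        unfolding f_def c_def
        by (rule reg_f_le_sum)
          (use that N y01[OF j] fill_range(2)[OF assms(3) j] in \<open>auto simp: y_def simp del: fill.simps(2)\<close>)
      also have "\<dots> = S k" unfolding S_def f_def
        by (rule sum.cong) (use that N yd in auto)
      finally show ?thesis .
    qed
    have df: "0 \<le> d s j * f s j" if "s \<in> {1..N}" for s
      using that N d0 y01[OF j, of s] unfolding f_def by (intro mult_nonneg_nonneg reg_f_nonneg) auto
    have SN: "S k \<le> S N" if "k \<le> N" for k
      unfolding S_def by (rule sum_mono2) (use that df in auto)
    \<comment> \<open>The exponent \<open>K - N\<close> is 1, so \<open>f N j\<close> is the level
      itself and the factor \<open>1 - y N j\<close> of the last stage fits the pattern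
      \<open>1 - f k j\<close>.\<close>
    have fN: "f N j = y N j" using N by (simp add: f_def reg_f_def)
    have zsum: "degree_off E z j = (\<Sum>k=1..N. zd k j) + zd K j"
      unfolding degree_off_eq_sum_stages[OF assms(2)] by (simp add: N zd_def D_def)
    have "0 \<le> S N" unfolding S_def by (rule sum_nonneg) (use df in auto)
    moreover have "degree_off E z j \<le> 1" using z j by (auto simp: frac_matching_def)
    \<comment> \<open>Because \<open>z\<close> has total degree at most 1 at \<open>j\<close>, the
      whole credit can be granted to every unit of \<open>z\<close> without overspending.\<close>
    ultimately have "degree_off E z j * S N \<le> S N"
      by (intro mult_left_le_one_le degree_off_nonneg[OF z]) auto
    moreover have "(1 - c) * degree_off E z j - degree_off E z j * S N
        = (\<Sum>k=1..N. zd k j * (1 - c - S N)) + zd K j * (1 - c - S N)"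
      unfolding zsum by (simp add: algebra_simps sum.distrib sum_subtractf sum_distrib_left)
    moreover have "\<dots> \<le> (\<Sum>k=1..N. zd k j * (1 - f k j)) + zd K j * (1 - y N j)"
    proof (intro add_mono sum_mono mult_left_mono)
      fix k assume "k \<in> {1..N}"
      then show "1 - c - S N \<le> 1 - f k j" "0 \<le> zd k j"
        using S[of k] SN[of k] zd0[of k j] N by auto
    qed (use S[of N] fN zd0[of K j] N in auto)
    ultimately show ?thesis by (simp add: sum.distrib S_def)
  qed
  have "ratio K * OPT U V E w = (\<Sum>j\<in>V. w j * ((1 - c) * degree_off E z j))"
    unfolding opt edge_weight_eq_degrees[OF E edges finite_V] ratio_def c_def
    by (simp add: sum_distrib_left mult_ac)
  also have "\<dots> \<le> (\<Sum>j\<in>V. w j * ((\<Sum>k=1..N. zd k j * (1 - f k j) + d k j * f k j)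
      + zd K j * (1 - y N j)))"
    by (intro sum_mono mult_left_mono point weight_nonneg)
  also have "\<dots> = (\<Sum>k=1..N. \<Sum>j\<in>V. w j * (zd k j * (1 - f k j) + d k j * f k j))
      + (\<Sum>j\<in>V. w j * (zd K j * (1 - y N j)))"
    unfolding distrib_left[of "w _" "sum _ _"] sum.distrib[of _ _ V] sum_distrib_left
    by (subst sum.swap) simp
  also have "\<dots> \<le> (\<Sum>k=1..N. \<Sum>j\<in>V. w j * d k j) + (\<Sum>j\<in>V. w j * d K j)"
    by (intro add_mono sum_mono early late)
  also have "\<dots> = (\<Sum>k=1..K. \<Sum>j\<in>V. w j * d k j)"
    using N by simp
  also have "\<dots> = (\<Sum>j\<in>V. w j * fill B E x K j)"
    unfolding fill_eq_sum d_def D_def sum_distrib_left by (rule sum.swap)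
  finally show ?thesis .
qed

end
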